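(* Let $G=(V,E)$ be a connected locally finite weighted graph with symmetric positive edge weights $w_{xy}$ and vertex measure $\mu:V\to(0,\infty)$. Let $h:V\to\mathbb{R}$ be a function for which there is a constant $a_0>0$ with $h(x)\ge a_0$ for all $x\in V$, and let $f:V\to\mathbb{R}$. Suppose that one of the following three hypotheses is satisfied: (i) $f\in L^2(V)$; (ii) there is a constant $\mu_0$ such that $\mu(x)\ge\mu_0>0$ for all $x\in V$, and $f\in L^1(V)$; (iii) there is a constant $w_0>0$ such that $w_{xy}\ge w_0$ for all $x,y\in V$ with $y\sim x$, the distance function $\rho(x)=\rho(x,O)$ belongs to $L^p(V)$ for some $p>1$ and some $O\in V$, and $f\in L^{p/(p-1)}(V)$. Then the equation $$-\Delta u+hu=f\quad\text{in } V,\qquad u\in\mathscr{H},$$ has a unique solution $u$. If in addition $f\ge0$ and $f\not\equiv0$ on $V$, then $u(x)>0$ for all $x\in V$.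
   Context: $G=(V,E)$ is a connected graph with vertex set $V$ and edge set $E$; $y\sim x$ means $xy\in E$. Each edge $xy\in E$ has a weight $w_{xy}>0$ with $w_{xy}=w_{yx}$, and $\mu:V\to(0,\infty)$ is a measure on the vertices. The distance $\rho(x,O)$ between $x$ and $O$ is the number of edges of a shortest path joining them (and $\rho(O,O)=0$). The graph is locally finite if for every $O\in V$ and every integer $k\ge1$ the ball $B_k=\{x\in V:\rho(x,O)<k\}$ is finite. For $f:V\to\mathbb{R}$, $\int_V f\,d\mu=\sum_{x\in V}\mu(x)f(x)$. For $q>0$, $L^q(V)$ is the space of functions $f:V\to\mathbb{R}$ with $\|f\|_{L^q(V)}=\left(\int_V|f|^q\,d\mu\right)^{1/q}<\infty$. The Laplacian is $\Delta u(x)=\frac{1}{\mu(x)}\sum_{y\sim x}w_{xy}(u(y)-u(x))$, and $|\nabla u|(x)=\left(\frac{1}{2\mu(x)}\sum_{y\sim x}w_{xy}(u(y)-u(x))^2\right)^{1/2}$. $W^{1,2}(V)$ is the space of functions $u:V\to\mathbb{R}$ with $\|u\|_{W^{1,2}(V)}=\left(\int_V(|\nabla u|^2+u^2)\,d\mu\right)^{1/2}<\infty$, and $W_0^{1,2}(V)$ is the completion (closure in $W^{1,2}(V)$) of the finitely supported functions $C_c(V)$ under this norm. For $h$ with a positive lower bound, $\mathscr{H}=\{u\in W_0^{1,2}(V):\int_V(|\nabla u|^2+hu^2)\,d\mu<\infty\}$. The equation is understood pointwise at every $x\in V$. *)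

theory Defs
  imports "HOL-Analysis.Analysis"
begin

text \<open>
  The vertex set is the type \<open>'a\<close>, so that functions on \<open>V\<close> are functions \<open>'a \<Rightarrow> real\<close> and equality
  on \<open>V\<close> is equality of functions. The edge set is a symmetric relation. Weights of pairs
  that are not edges are irrelevant. Loops are not excluded; they do not affect
  distances, Laplacians or gradients.
\<close>

text \<open>\<open>E ^^ n\<close> relates the end points of walks with \<open>n\<close> edges; a walk of least length is a shortest path.\<close>

definition graph_dist :: "('a \<times> 'a) set \<Rightarrow> 'a \<Rightarrow> 'a \<Rightarrow> nat" where
  "graph_dist E x y = (LEAST n. (x, y) \<in> E ^^ n)"

definition graph_ball :: "('a \<times> 'a) set \<Rightarrow> 'a \<Rightarrow> nat \<Rightarrow> 'a set" where
  "graph_ball E x0 k = {x. graph_dist E x x0 < k}"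

definition locally_finite_graph :: "('a \<times> 'a) set \<Rightarrow> bool" where
  "locally_finite_graph E \<longleftrightarrow> (\<forall>x0. \<forall>k\<ge>1. finite (graph_ball E x0 k))"

locale connected_weighted_graph =
  fixes E :: "('a \<times> 'a) set"
    and w :: "'a \<Rightarrow> 'a \<Rightarrow> real"
    and \<mu> :: "'a \<Rightarrow> real"
  assumes edges_sym: "sym E"
    and connected: "(x, y) \<in> E\<^sup>*"
    and weight_pos: "(x, y) \<in> E \<Longrightarrow> w x y > 0"
    and weight_sym: "(x, y) \<in> E \<Longrightarrow> w x y = w y x"
    and measure_pos: "\<mu> x > 0"

text \<open>
  Only nonnegative integrands are used below. For these, \<open>vintegrable\<close> says that the sum
  defining the integral is finite; where it is not, \<open>vintegral\<close> takes the default value 0,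
  so finiteness has to be expressed by \<open>vintegrable\<close>.
\<close>

definition vintegrable :: "('a \<Rightarrow> real) \<Rightarrow> ('a \<Rightarrow> real) \<Rightarrow> bool" where
  "vintegrable \<mu> f \<longleftrightarrow> (\<lambda>x. \<mu> x * f x) summable_on UNIV"

definition vintegral :: "('a \<Rightarrow> real) \<Rightarrow> ('a \<Rightarrow> real) \<Rightarrow> real" where
  "vintegral \<mu> f = (\<Sum>\<^sub>\<infinity>x. \<mu> x * f x)"

definition Lq_space :: "('a \<Rightarrow> real) \<Rightarrow> real \<Rightarrow> ('a \<Rightarrow> real) set" where
  "Lq_space \<mu> q = {f. vintegrable \<mu> (\<lambda>x. \<bar>f x\<bar> powr q)}"

text \<open>In a locally finite graph every vertex has finitely many neighbours, so the sums below are genuine.\<close>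

definition laplacian ::
    "('a \<times> 'a) set \<Rightarrow> ('a \<Rightarrow> 'a \<Rightarrow> real) \<Rightarrow> ('a \<Rightarrow> real) \<Rightarrow> ('a \<Rightarrow> real) \<Rightarrow> 'a \<Rightarrow> real" where
  "laplacian E w \<mu> u x = 1 / \<mu> x * (\<Sum>y | (x, y) \<in> E. w x y * (u y - u x))"

definition grad_norm ::
    "('a \<times> 'a) set \<Rightarrow> ('a \<Rightarrow> 'a \<Rightarrow> real) \<Rightarrow> ('a \<Rightarrow> real) \<Rightarrow> ('a \<Rightarrow> real) \<Rightarrow> 'a \<Rightarrow> real" where
  "grad_norm E w \<mu> u x = sqrt (1 / (2 * \<mu> x) * (\<Sum>y | (x, y) \<in> E. w x y * (u y - u x)\<^sup>2))"

definition W12 ::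
    "('a \<times> 'a) set \<Rightarrow> ('a \<Rightarrow> 'a \<Rightarrow> real) \<Rightarrow> ('a \<Rightarrow> real) \<Rightarrow> ('a \<Rightarrow> real) set" where
  "W12 E w \<mu> = {u. vintegrable \<mu> (\<lambda>x. (grad_norm E w \<mu> u x)\<^sup>2 + (u x)\<^sup>2)}"

definition W12_norm ::
    "('a \<times> 'a) set \<Rightarrow> ('a \<Rightarrow> 'a \<Rightarrow> real) \<Rightarrow> ('a \<Rightarrow> real) \<Rightarrow> ('a \<Rightarrow> real) \<Rightarrow> real" where
  "W12_norm E w \<mu> u = sqrt (vintegral \<mu> (\<lambda>x. (grad_norm E w \<mu> u x)\<^sup>2 + (u x)\<^sup>2))"

definition Cc :: "('a \<Rightarrow> real) set" where
  "Cc = {\<phi>. finite {x. \<phi> x \<noteq> 0}}"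

text \<open>
  The closure of \<open>Cc\<close> in \<open>W12\<close>. Local finiteness gives \<open>Cc \<subseteq> W12\<close>, so for \<open>u \<in> W12\<close> the
  difference \<open>u - \<phi>\<close> lies in \<open>W12\<close> and its norm is not a default value.
\<close>

definition W12_0 ::
    "('a \<times> 'a) set \<Rightarrow> ('a \<Rightarrow> 'a \<Rightarrow> real) \<Rightarrow> ('a \<Rightarrow> real) \<Rightarrow> ('a \<Rightarrow> real) set" where
  "W12_0 E w \<mu> =
    {u \<in> W12 E w \<mu>. \<forall>\<epsilon>>0. \<exists>\<phi>\<in>Cc. W12_norm E w \<mu> (\<lambda>x. u x - \<phi> x) < \<epsilon>}"

definition H_space ::
    "('a \<times> 'a) set \<Rightarrow> ('a \<Rightarrow> 'a \<Rightarrow> real) \<Rightarrow> ('a \<Rightarrow> real) \<Rightarrow> ('a \<Rightarrow> real) \<Rightarrow> ('a \<Rightarrow> real) set" where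
  "H_space E w \<mu> h =
    {u \<in> W12_0 E w \<mu>. vintegrable \<mu> (\<lambda>x. (grad_norm E w \<mu> u x)\<^sup>2 + h x * (u x)\<^sup>2)}"

definition is_solution ::
    "('a \<times> 'a) set \<Rightarrow> ('a \<Rightarrow> 'a \<Rightarrow> real) \<Rightarrow> ('a \<Rightarrow> real) \<Rightarrow> ('a \<Rightarrow> real) \<Rightarrow> ('a \<Rightarrow> real) \<Rightarrow>
      ('a \<Rightarrow> real) \<Rightarrow> bool" where
  "is_solution E w \<mu> h f u \<longleftrightarrow>
    u \<in> H_space E w \<mu> h \<and> (\<forall>x. - laplacian E w \<mu> u x + h x * u x = f x)"

end

theory Submission
  imports Defs
begin

text \<open>
  Existence: the energy \<open>\<Phi>(\<phi>) = (\<integral>|\<nabla>\<phi>|\<^sup>2 + h \<phi>\<^sup>2) / 2 - \<integral>f \<phi>\<close> is bounded below on \<open>Cc\<close>: complete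
  the square under (i), and use a pointwise bound \<open>|\<phi>| \<le> g \<cdot> \<parallel>\<phi>\<parallel>\<close> with \<open>f g \<in> L\<^sup>1\<close> under (ii) and (iii),
  where in (iii) \<open>g\<close> is affine in the distance and is obtained by summing edge differences along a
  shortest path. By the parallelogram identity a minimising sequence in \<open>Cc\<close> is Cauchy for the
  energy norm; hence it converges pointwise and, by lower semicontinuity, in norm to a function of
  \<open>\<H>\<close>. Perturbing by multiples of a point mass shows that the limit solves the equation at each vertex.

  Uniqueness and nonnegativity follow from a weak maximum principle on \<open>W12_0\<close>, tested with a
  truncation of the negative part; positivity follows by propagating a zero along edges.
\<close>

section \<open>Infinite sums and elementary real inequalities\<close>

lemma summable_on_nonneg_comparison:
  fixes f g :: "'a \<Rightarrow> real"
  assumes "g summable_on A" "\<And>x. x \<in> A \<Longrightarrow> 0 \<le> f x" "\<And>x. x \<in> A \<Longrightarrow> f x \<le> g x"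
  shows "f summable_on A"
proof (rule nonneg_bdd_above_summable_on)
  have "sum f F \<le> infsum g A" if "finite F" "F \<subseteq> A" for F
  proof -
    have "sum f F \<le> sum g F" using assms that by (intro sum_mono) auto
    also have "\<dots> \<le> infsum g A"
      using assms that by (intro finite_sum_le_infsum) (auto intro: order_trans)
    finally show ?thesis .
  qed
  then show "bdd_above (sum f ` {F. F \<subseteq> A \<and> finite F})" by (intro bdd_aboveI2) auto
qed (use assms in auto)

lemma infsum_eq_sum_support:
  assumes "\<And>x. x \<notin> F \<Longrightarrow> g x = 0"
  shows "infsum g UNIV = infsum g F"
  using assms by (intro infsum_cong_neutral) auto

lemma summable_on_finite_support:
  fixes g :: "'a \<Rightarrow> real"
  assumes "finite F" "\<And>x. x \<notin> F \<Longrightarrow> g x = 0"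
  shows "g summable_on UNIV"
  using summable_on_cong_neutral[of F UNIV g g] assms summable_on_finite[of F g] by auto

text \<open>For small \<open>t\<close> of sign opposite to \<open>a\<close> the linear term
  dominates. Since \<open>s > b\<close>, the value \<open>t = - a / s\<close> is small enough: it
  gives \<open>a\<^sup>2 / s * (b / s - 1) < 0\<close>.\<close>

lemma nonneg_quadratic_imp_linear_coeff_zero:
  fixes a b :: real
  assumes "\<And>t. t * a + t\<^sup>2 * b \<ge> 0"
  shows "a = 0"
proof (rule ccontr)
  assume "a \<noteq> 0"
  define s where "s = 2 * (\<bar>b\<bar> + 1)"
  have "s > 0" by (simp add: s_def)
  have "(- a / s) * a + (- a / s)\<^sup>2 * b \<ge> 0" using assms .
  moreover have "(- a / s) * a + (- a / s)\<^sup>2 * b = a\<^sup>2 / s * (b / s - 1)"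
    using \<open>s > 0\<close> by (simp add: field_simps power2_eq_square)
  moreover have "b / s - 1 < 0" using \<open>s > 0\<close> by (simp add: s_def field_simps)
  moreover have "a\<^sup>2 / s > 0" using \<open>s > 0\<close> \<open>a \<noteq> 0\<close> by simp
  ultimately show False by (smt (verit) mult_pos_neg)
qed

text \<open>Here \<open>a\<close>, \<open>b\<close> stand for the values of \<open>u\<close> at the
  ends of an edge, and \<open>c\<close>, \<open>d\<close> for those of \<open>u - \<phi>\<close>.
  Where the truncation changes by \<open>\<delta>\<close>, \<open>u\<close> changes by
  \<open>- \<delta>\<close> up to an error on the favourable side of at most
  \<open>\<bar>t\<bar>\<close>; the resulting
  \<open>- \<delta>\<^sup>2 + \<bar>t\<bar> * \<bar>\<delta>\<bar>\<close> is at most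
  \<open>t\<^sup>2 / 4\<close> by completing the square.\<close>

lemma truncation_edge_bound:
  fixes a b c d :: real
  shows "(b - a) * (max 0 (- b - \<bar>d\<bar>) - max 0 (- a - \<bar>c\<bar>)) \<le> (d - c)\<^sup>2 / 4"
proof -
  define \<delta> where "\<delta> = max 0 (- b - \<bar>d\<bar>) - max 0 (- a - \<bar>c\<bar>)"
  define t where "t = \<bar>d\<bar> - \<bar>c\<bar>"
  have "(b - a) * \<delta> \<le> - \<delta> * \<delta> + \<bar>t\<bar> * \<bar>\<delta>\<bar>"
  proof (cases "\<delta> \<ge> 0")
    case True
    have "b - a \<le> - \<delta> + \<bar>t\<bar> \<or> \<delta> = 0" using True unfolding \<delta>_def t_def by linarith
    then show ?thesis using mult_right_mono[of "b - a" "- \<delta> + \<bar>t\<bar>" \<delta>] True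
      by (auto simp: algebra_simps)
  next
    case False
    have "b - a \<ge> - \<delta> - \<bar>t\<bar>" using False unfolding \<delta>_def t_def by linarith
    then show ?thesis using mult_right_mono_neg[of "- \<delta> - \<bar>t\<bar>" "b - a" \<delta>] False
      by (auto simp: algebra_simps)
  qed
  also have "\<dots> \<le> t\<^sup>2 / 4"
    using zero_le_power2[of "\<bar>t\<bar> / 2 - \<bar>\<delta>\<bar>"] by (simp add: power2_eq_square algebra_simps)
  also have "\<dots> \<le> (d - c)\<^sup>2 / 4"
    using abs_le_square_iff[of t "d - c"] abs_triangle_ineq3[of d c] by (simp add: t_def)
  finally show ?thesis by (simp add: \<delta>_def)
qed

section \<open>Finitely supported functions\<close>

lemma Cc_add: "\<phi> \<in> Cc \<Longrightarrow> \<psi> \<in> Cc \<Longrightarrow> (\<lambda>x. \<phi> x + \<psi> x) \<in> Cc"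
  unfolding Cc_def mem_Collect_eq
  by (rule finite_subset[of _ "{x. \<phi> x \<noteq> 0} \<union> {x. \<psi> x \<noteq> 0}"]) auto

lemma Cc_scale: "\<phi> \<in> Cc \<Longrightarrow> (\<lambda>x. t * \<phi> x) \<in> Cc"
  unfolding Cc_def mem_Collect_eq by (rule finite_subset[of _ "{x. \<phi> x \<noteq> 0}"]) auto

lemma Cc_diff: "\<phi> \<in> Cc \<Longrightarrow> \<psi> \<in> Cc \<Longrightarrow> (\<lambda>x. \<phi> x - \<psi> x) \<in> Cc"
  using Cc_add[OF _ Cc_scale[of \<psi> "-1"], of \<phi>] by simp

lemma Cc_zero: "(\<lambda>x. 0) \<in> Cc" and Cc_delta: "(\<lambda>x. of_bool (x = a)) \<in> Cc"
  by (simp_all add: Cc_def)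

section \<open>The bilinear form of the equation\<close>

locale locally_finite_weighted_graph = connected_weighted_graph E w \<mu>
  for E :: "('a \<times> 'a) set" and w \<mu> +
  assumes loc_fin: "locally_finite_graph E"
begin

lemma edge_swap: "(x, y) \<in> E \<longleftrightarrow> (y, x) \<in> E"
  using edges_sym by (meson symD)

lemma finite_nbrs: "finite {y. (x, y) \<in> E}"
proof (rule finite_subset)
  \<comment> \<open>Balls are defined by a strict inequality, so neighbours, at distance at most 1,
    need radius 2.\<close>
  show "{y. (x, y) \<in> E} \<subseteq> graph_ball E x 2"
  proof safe
    fix y assume "(x, y) \<in> E"
    then have "(y, x) \<in> E ^^ 1" using edge_swap by simp
    then have "graph_dist E y x \<le> 1" unfolding graph_dist_def by (rule Least_le)
    then show "y \<in> graph_ball E x 2" by (simp add: graph_ball_def)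
  qed
  show "finite (graph_ball E x 2)" using loc_fin unfolding locally_finite_graph_def by auto
qed

text \<open>The measure is already multiplied in, which cancels the \<open>1 / \<mu> x\<close> of
  the gradient. The factor 1/2 compensates for each edge being met from both ends. The potential
  \<open>c = 1\<close> belongs to the norm of \<open>W12\<close>, and \<open>c = h\<close> to the
  energy of the equation.\<close>

definition form_density :: "('a \<Rightarrow> real) \<Rightarrow> ('a \<Rightarrow> real) \<Rightarrow> ('a \<Rightarrow> real) \<Rightarrow> 'a \<Rightarrow> real" where
  "form_density c u v x =
     (\<Sum>y | (x, y) \<in> E. w x y * (u y - u x) * (v y - v x)) / 2 + \<mu> x * c x * u x * v x"

definition form :: "('a \<Rightarrow> real) \<Rightarrow> ('a \<Rightarrow> real) \<Rightarrow> ('a \<Rightarrow> real) \<Rightarrow> real" where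
  "form c u v = (\<Sum>\<^sub>\<infinity>x. form_density c u v x)"

definition schroedinger :: "('a \<Rightarrow> real) \<Rightarrow> ('a \<Rightarrow> real) \<Rightarrow> 'a \<Rightarrow> real" where
  "schroedinger c u x = - laplacian E w \<mu> u x + c x * u x"

lemma measure_grad_norm:
  "\<mu> x * ((grad_norm E w \<mu> u x)\<^sup>2 + c x * (u x)\<^sup>2) = form_density c u u x"
proof -
  have "(\<Sum>y | (x, y) \<in> E. w x y * (u y - u x)\<^sup>2) \<ge> 0"
    using weight_pos by (intro sum_nonneg mult_nonneg_nonneg) (auto intro: less_imp_le)
  then have "(grad_norm E w \<mu> u x)\<^sup>2 = 1 / (2 * \<mu> x) * (\<Sum>y | (x, y) \<in> E. w x y * (u y - u x)\<^sup>2)"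
    unfolding grad_norm_def using measure_pos[of x] by (intro real_sqrt_pow2) auto
  then show ?thesis
    using measure_pos[of x]
    by (simp add: form_density_def field_simps power2_eq_square)
qed

lemma W12_iff: "u \<in> W12 E w \<mu> \<longleftrightarrow> form_density (\<lambda>_. 1) u u summable_on UNIV"
  and W12_norm_eq: "W12_norm E w \<mu> u = sqrt (form (\<lambda>_. 1) u u)"
  using measure_grad_norm[of _ u "\<lambda>_. 1"]
  by (simp_all add: W12_def W12_norm_def vintegrable_def vintegral_def form_def)

lemma H_space_iff:
  "u \<in> H_space E w \<mu> h \<longleftrightarrow> u \<in> W12_0 E w \<mu> \<and> form_density h u u summable_on UNIV"
  using measure_grad_norm[of _ u h] by (simp add: H_space_def vintegrable_def)

lemma form_density_add_left:
  "form_density c (\<lambda>x. u x + u' x) v x = form_density c u v x + form_density c u' v x"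
proof -
  have "(\<Sum>y | (x, y) \<in> E. w x y * (u y + u' y - (u x + u' x)) * (v y - v x)) =
    (\<Sum>y | (x, y) \<in> E. w x y * (u y - u x) * (v y - v x)) +
    (\<Sum>y | (x, y) \<in> E. w x y * (u' y - u' x) * (v y - v x))"
    unfolding sum.distrib[symmetric] by (intro sum.cong) (auto simp: algebra_simps)
  then show ?thesis unfolding form_density_def by (simp add: field_simps)
qed

lemma form_density_scale_left:
  "form_density c (\<lambda>x. t * u x) v x = t * form_density c u v x"
proof -
  have "(\<Sum>y | (x, y) \<in> E. w x y * (t * u y - t * u x) * (v y - v x)) =
    t * (\<Sum>y | (x, y) \<in> E. w x y * (u y - u x) * (v y - v x))"
    unfolding sum_distrib_left by (intro sum.cong) (auto simp: algebra_simps)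
  then show ?thesis unfolding form_density_def by (simp add: field_simps)
qed

lemma form_density_commute: "form_density c u v x = form_density c v u x"
  unfolding form_density_def by (simp add: mult.commute mult.left_commute)

lemma form_density_add_scale:
  "form_density c (\<lambda>x. u x + t * v x) (\<lambda>x. u x + t * v x) x =
    form_density c u u x + 2 * t * form_density c u v x + t\<^sup>2 * form_density c v v x"
proof -
  let ?s = "\<lambda>x. u x + t * v x"
  have "form_density c ?s ?s x = form_density c u ?s x + t * form_density c v ?s x"
    by (simp add: form_density_add_left form_density_scale_left)
  also have "\<dots> = form_density c ?s u x + t * form_density c ?s v x"
    by (simp add: form_density_commute)
  also have "\<dots> = form_density c u u x + t * form_density c v u x +
      t * (form_density c u v x + t * form_density c v v x)"
    by (simp add: form_density_add_left form_density_scale_left)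
  also have "form_density c v u x = form_density c u v x" by (rule form_density_commute)
  finally show ?thesis by (simp add: algebra_simps power2_eq_square)
qed

lemma edge_sum_nonneg: "(\<Sum>y | (x, y) \<in> E. w x y * (u y - u x) * (u y - u x)) \<ge> 0"
  unfolding mult.assoc using weight_pos
  by (intro sum_nonneg mult_nonneg_nonneg[OF _ zero_le_square]) (auto intro: less_imp_le)

lemma form_density_ge:
  "form_density c u u x \<ge> \<mu> x * c x * (u x)\<^sup>2"
  using edge_sum_nonneg[of x u] by (simp add: form_density_def power2_eq_square mult.assoc)

lemma form_density_nonneg: "c x \<ge> 0 \<Longrightarrow> form_density c u u x \<ge> 0"
  using form_density_ge[where c = c and u = u and x = x] measure_pos[of x] 
  by (smt (verit) mult_nonneg_nonneg zero_le_power2)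

text \<open>The parallelogram identity, with the nonnegative density of \<open>u - v\<close>
  dropped. It replaces the triangle inequality throughout.\<close>

lemma form_density_add_le:
  assumes "c x \<ge> 0"
  shows "form_density c (\<lambda>x. u x + v x) (\<lambda>x. u x + v x) x \<le>
    2 * form_density c u u x + 2 * form_density c v v x"
  using form_density_add_scale[where t = 1 and u = u and v = v and c = c and x = x]
    form_density_add_scale[where t = "-1" and u = u and v = v and c = c and x = x]
    form_density_nonneg[where c = c and x = x and u = "\<lambda>x. u x + (-1) * v x"] assms
  by simp

lemma form_density_minus: "form_density c (\<lambda>x. - u x) (\<lambda>x. - u x) x = form_density c u u x"
  \<comment> \<open>Write \<open>- u\<close> as \<open>u + (-2) * u\<close>; the coefficients add up
    to 1 - 4 + 4 = 1.\<close>
  using form_density_add_scale[where t = "-2" and u = u and v = u and c = c and x = x] by simp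

section \<open>Test functions and summation by parts\<close>

text \<open>The density at a vertex also sees the neighbours, so the support of a test function must
  be enlarged by one layer before a sum over it captures the whole form.\<close>

definition closed_nbhd :: "'a set \<Rightarrow> 'a set" where
  "closed_nbhd S = S \<union> (\<Union>x\<in>S. {y. (x, y) \<in> E})"

lemma finite_closed_nbhd: "finite S \<Longrightarrow> finite (closed_nbhd S)"
  using finite_nbrs by (simp add: closed_nbhd_def)

lemma form_density_eq_0:
  assumes "x \<notin> closed_nbhd {x. v x \<noteq> 0}"
  shows "form_density c u v x = 0"
proof -
  have "v x = 0" using assms by (auto simp: closed_nbhd_def)
  moreover have "v y = 0" if "(x, y) \<in> E" for y
    using assms that edge_swap by (auto simp: closed_nbhd_def)
  ultimately show ?thesis by (auto simp: form_density_def intro!: sum.neutral)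
qed

lemma form_density_summable: "v \<in> Cc \<Longrightarrow> form_density c u v summable_on UNIV"
  using summable_on_finite_support[OF finite_closed_nbhd form_density_eq_0] by (auto simp: Cc_def)

lemma form_eq_sum:
  assumes "finite F" "closed_nbhd {x. v x \<noteq> 0} \<subseteq> F"
  shows "form c u v = sum (form_density c u v) F"
proof -
  have "form c u v = infsum (form_density c u v) F"
    unfolding form_def using assms form_density_eq_0 by (intro infsum_eq_sum_support) blast
  then show ?thesis using assms by simp
qed

lemma schroedinger_eq:
  "\<mu> x * schroedinger c u x = \<mu> x * c x * u x - (\<Sum>y | (x, y) \<in> E. w x y * (u y - u x))"
  using measure_pos[of x] by (simp add: schroedinger_def laplacian_def field_simps)

text \<open>Summation by parts: exchanging the two ends of each edge turns the part with
  \<open>v y\<close> into minus the part with \<open>v x\<close>. Since \<open>v\<close> has finite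
  support all sums are finite, and \<open>u\<close> may be arbitrary.\<close>

lemma green_formula:
  assumes "finite F" "closed_nbhd {x. v x \<noteq> 0} \<subseteq> F"
  shows "form c u v = (\<Sum>x\<in>F. \<mu> x * schroedinger c u x * v x)"
proof -
  \<comment> \<open>Extending the weights by zero lets both ends of an edge range over the same
    finite set \<open>F\<close>, so that the double sums can be swapped.\<close>
  define W where "W x y = (if (x, y) \<in> E then w x y else 0)" for x y
  have W_sym: "W x y = W y x" for x y using weight_sym edge_swap by (auto simp: W_def)
  have restrict: "(\<Sum>y | (x, y) \<in> E. w x y * g y) = (\<Sum>y\<in>F. W x y * g y)"
    if "\<And>y. (x, y) \<in> E \<Longrightarrow> y \<notin> F \<Longrightarrow> g y = 0" for x and g :: "'a \<Rightarrow> real"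
    using assms(1) that finite_nbrs by (intro sum.mono_neutral_cong) (auto simp: W_def)
  have outside: "v y = 0" if "y \<notin> F" for y using assms(2) that by (auto simp: closed_nbhd_def)
  \<comment> \<open>An edge leaving \<open>F\<close> cannot start in the support of
    \<open>v\<close>, because \<open>F\<close> contains all neighbours of the support. Hence such
    edges contribute nothing.\<close>
  have outside': "v x = 0" if "y \<notin> F" "(x, y) \<in> E" for x y
    using assms(2) that by (auto simp: closed_nbhd_def)
  define A where "A = (\<Sum>x\<in>F. \<Sum>y\<in>F. W x y * (u y - u x) * v x)"
  have "(\<Sum>x\<in>F. \<Sum>y\<in>F. W x y * ((u y - u x) * (v y - v x))) =
      (\<Sum>x\<in>F. \<Sum>y\<in>F. W x y * (u y - u x) * v y) - A"
    unfolding A_def sum_subtractf[symmetric] by (intro sum.cong refl) (simp add: algebra_simps)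
  also have "(\<Sum>x\<in>F. \<Sum>y\<in>F. W x y * (u y - u x) * v y) = (\<Sum>x\<in>F. \<Sum>y\<in>F. W y x * (u x - u y) * v x)"
    by (rule sum.swap)
  also have "\<dots> = - A"
    unfolding A_def sum_negf[symmetric] by (intro sum.cong refl) (auto simp: W_sym algebra_simps)
  finally have *: "(\<Sum>x\<in>F. \<Sum>y\<in>F. W x y * ((u y - u x) * (v y - v x))) = - 2 * A" by simp
  have "form c u v = (\<Sum>x\<in>F. (\<Sum>y | (x, y) \<in> E. w x y * ((u y - u x) * (v y - v x))) / 2
      + \<mu> x * c x * u x * v x)"
    unfolding form_eq_sum[OF assms] form_density_def by (simp add: mult.assoc)
  also have "\<dots> = (\<Sum>x\<in>F. (\<Sum>y\<in>F. W x y * ((u y - u x) * (v y - v x))) / 2 + \<mu> x * c x * u x * v x)"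
    by (intro sum.cong refl arg_cong2[where f = "(+)"] arg_cong2[where f = "(/)"] restrict)
      (use outside outside' in auto)
  also have "\<dots> = - A + (\<Sum>x\<in>F. \<mu> x * c x * u x * v x)"
    using * by (simp add: sum.distrib sum_divide_distrib[symmetric])
  also have "A = (\<Sum>x\<in>F. (\<Sum>y | (x, y) \<in> E. w x y * ((u y - u x) * v x)))"
    unfolding A_def mult.assoc
    by (intro sum.cong refl restrict[symmetric]) (use outside' in auto)
  also have "- \<dots> + (\<Sum>x\<in>F. \<mu> x * c x * u x * v x) = (\<Sum>x\<in>F. \<mu> x * schroedinger c u x * v x)"
    by (simp add: schroedinger_eq left_diff_distrib sum_subtractf sum_distrib_right mult.assoc)
  finally show ?thesis .
qed

section \<open>Approximation in \<open>W12_0\<close>\<close>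

text \<open>The summability is recorded together with the smallness, since a small value of
  \<open>form\<close> alone could be the default value of a divergent sum.\<close>

lemma W12_0_approx:
  assumes "u \<in> W12_0 E w \<mu>" "\<epsilon> > 0"
  obtains \<phi> where "\<phi> \<in> Cc" "form (\<lambda>_. 1) (\<lambda>x. u x - \<phi> x) (\<lambda>x. u x - \<phi> x) < \<epsilon>"
    "form_density (\<lambda>_. 1) (\<lambda>x. u x - \<phi> x) (\<lambda>x. u x - \<phi> x) summable_on UNIV"
proof -
  obtain \<phi> where \<phi>: "\<phi> \<in> Cc" "W12_norm E w \<mu> (\<lambda>x. u x - \<phi> x) < sqrt \<epsilon>"
    using assms unfolding W12_0_def by (auto dest: spec[of _ "sqrt \<epsilon>"])
  have u: "form_density (\<lambda>_. 1) u u summable_on UNIV"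
    using assms W12_iff by (auto simp: W12_0_def)
  have "(\<lambda>x. 2 * form_density (\<lambda>_. 1) u u x + 2 * form_density (\<lambda>_. 1) \<phi> \<phi> x) summable_on UNIV"
    by (intro summable_on_add summable_on_cmult_right u form_density_summable \<phi>)
  then have "form_density (\<lambda>_. 1) (\<lambda>x. u x - \<phi> x) (\<lambda>x. u x - \<phi> x) summable_on UNIV"
    by (rule summable_on_nonneg_comparison)
      (use form_density_add_le[where c = "\<lambda>_. 1" and u = u and v = "\<lambda>x. - \<phi> x"]
       in \<open>auto simp: form_density_minus intro: form_density_nonneg\<close>)
  with \<phi> show ?thesis by (intro that) (auto simp: W12_norm_eq)
qed

lemma W12_0_diff:
  assumes u: "u \<in> W12_0 E w \<mu>" and v: "v \<in> W12_0 E w \<mu>"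
  shows "(\<lambda>x. u x - v x) \<in> W12_0 E w \<mu>"
proof -
  let ?c = "\<lambda>_::'a. 1::real"
  have bound: "form_density ?c (\<lambda>x. p x - q x) (\<lambda>x. p x - q x) x \<le>
      2 * form_density ?c p p x + 2 * form_density ?c q q x" for p q x
    using form_density_add_le[where c = ?c and u = p and v = "\<lambda>x. - q x" and x = x]
    by (simp add: form_density_minus)
  have "form_density ?c (\<lambda>x. u x - v x) (\<lambda>x. u x - v x) summable_on UNIV"
    by (rule summable_on_nonneg_comparison[where g =
          "\<lambda>x. 2 * form_density ?c u u x + 2 * form_density ?c v v x"])
      (use u v W12_iff in \<open>auto simp: W12_0_def bound
          intro!: summable_on_add summable_on_cmult_right form_density_nonneg\<close>)
  moreover have "\<exists>\<phi>\<in>Cc. W12_norm E w \<mu> (\<lambda>x. u x - v x - \<phi> x) < \<epsilon>" if "\<epsilon> > 0" for \<epsilon>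
  proof -
    \<comment> \<open>Each of the two errors is doubled by \<open>bound\<close>, so
      \<open>\<epsilon>\<^sup>2 / 4\<close> for each gives \<open>\<epsilon>\<^sup>2\<close> in
      total.\<close>
    have \<epsilon>: "\<epsilon>\<^sup>2 / 4 > 0" using that by simp
    obtain \<phi> where \<phi>: "\<phi> \<in> Cc" "form ?c (\<lambda>x. u x - \<phi> x) (\<lambda>x. u x - \<phi> x) < \<epsilon>\<^sup>2 / 4"
      "form_density ?c (\<lambda>x. u x - \<phi> x) (\<lambda>x. u x - \<phi> x) summable_on UNIV"
      using W12_0_approx[OF u \<epsilon>] .
    obtain \<psi> where \<psi>: "\<psi> \<in> Cc" "form ?c (\<lambda>x. v x - \<psi> x) (\<lambda>x. v x - \<psi> x) < \<epsilon>\<^sup>2 / 4"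
      "form_density ?c (\<lambda>x. v x - \<psi> x) (\<lambda>x. v x - \<psi> x) summable_on UNIV"
      using W12_0_approx[OF v \<epsilon>] .
    let ?d = "\<lambda>x. u x - v x - (\<phi> x - \<psi> x)"
    have d: "?d = (\<lambda>x. (u x - \<phi> x) - (v x - \<psi> x))" by auto
    let ?b = "\<lambda>x. 2 * form_density ?c (\<lambda>x. u x - \<phi> x) (\<lambda>x. u x - \<phi> x) x +
      2 * form_density ?c (\<lambda>x. v x - \<psi> x) (\<lambda>x. v x - \<psi> x) x"
    have b: "?b summable_on UNIV"
      by (intro summable_on_add summable_on_cmult_right \<phi> \<psi>)
    have le: "form_density ?c ?d ?d x \<le> ?b x" for x unfolding d by (rule bound)
    have "form_density ?c ?d ?d summable_on UNIV"
      by (rule summable_on_nonneg_comparison[OF b _ le]) (auto intro: form_density_nonneg)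
    then have "form ?c ?d ?d \<le> infsum ?b UNIV"
      unfolding form_def using b le by (intro infsum_mono)
    also have "\<dots> = 2 * form ?c (\<lambda>x. u x - \<phi> x) (\<lambda>x. u x - \<phi> x) +
        2 * form ?c (\<lambda>x. v x - \<psi> x) (\<lambda>x. v x - \<psi> x)"
      unfolding form_def using \<phi> \<psi>
      by (subst infsum_add) (auto simp: infsum_cmult_right' intro: summable_on_cmult_right)
    also have "\<dots> < \<epsilon>\<^sup>2" using \<phi> \<psi> by simp
    finally have "sqrt (form ?c ?d ?d) < \<epsilon>" using that real_less_lsqrt by simp
    then show ?thesis using Cc_diff[OF \<phi>(1) \<psi>(1)]
      by (intro bexI[of _ "\<lambda>x. \<phi> x - \<psi> x"]) (auto simp: W12_norm_eq)
  qed
  ultimately show ?thesis by (auto simp: W12_0_def W12_iff)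
qed

section \<open>Maximum principles\<close>

text \<open>
  The negative part of \<open>u\<close> need not be an admissible test function; it is replaced by its
  soft truncation at level \<open>\<bar>u - \<phi>\<bar>\<close>, where \<open>\<phi> \<in> Cc\<close> is close
  to \<open>u\<close>: this truncation vanishes wherever \<open>\<phi>\<close> does.
\<close>

lemma weak_maximum_principle:
  assumes u: "u \<in> W12_0 E w \<mu>" and c: "\<And>x. c x > 0"
    and super: "\<And>x. schroedinger c u x \<ge> 0"
  shows "u a \<ge> 0"
proof (rule ccontr)
  assume "\<not> u a \<ge> 0"
  define m where "m = - u a"
  have m: "m > 0" using \<open>\<not> u a \<ge> 0\<close> by (simp add: m_def)
  \<comment> \<open>The first entry forces \<open>\<bar>v a\<bar> \<le> m / 2\<close>, hence
    \<open>\<psi> a \<ge> m / 2\<close>. The second makes the tested inequality fail at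
    \<open>a\<close>: it would yield \<open>\<mu> a * c a * m\<^sup>2 / 2 \<le> \<mu> a * c a *
    m\<^sup>2 / 4\<close>.\<close>
  define e where "e = min (\<mu> a * m\<^sup>2 / 4) (\<mu> a * c a * m\<^sup>2)"
  have "e > 0" using m c[of a] measure_pos[of a] by (simp add: e_def)
  obtain \<phi> where \<phi>: "\<phi> \<in> Cc" "form (\<lambda>_. 1) (\<lambda>x. u x - \<phi> x) (\<lambda>x. u x - \<phi> x) < e"
    "form_density (\<lambda>_. 1) (\<lambda>x. u x - \<phi> x) (\<lambda>x. u x - \<phi> x) summable_on UNIV"
    using W12_0_approx[OF u \<open>e > 0\<close>] .
  define v where "v = (\<lambda>x. u x - \<phi> x)"
  define \<psi> where "\<psi> x = max 0 (- u x - \<bar>v x\<bar>)" for x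
  define F where "F = closed_nbhd {x. \<phi> x \<noteq> 0} \<union> {a}"
  have sum_le: "sum (form_density (\<lambda>_. 1) v v) A \<le> e" if "finite A" for A
  proof -
    have "sum (form_density (\<lambda>_. 1) v v) A \<le> form (\<lambda>_. 1) v v"
      unfolding form_def using \<phi> that v_def
      by (intro finite_sum_le_infsum form_density_nonneg) auto
    with \<phi> show ?thesis by (simp add: v_def)
  qed
  have F: "finite F" using \<phi> finite_closed_nbhd by (auto simp: F_def Cc_def)
  have "\<psi> x = 0" if "\<phi> x = 0" for x using that by (simp add: \<psi>_def v_def)
  then have supp: "closed_nbhd {x. \<psi> x \<noteq> 0} \<subseteq> F" unfolding F_def closed_nbhd_def by auto
  \<comment> \<open>Only the edge part is estimated, against the gradient of the small function
    \<open>v\<close>. The potential part is kept exactly, because its negativity at \<open>a\<close>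
    gives the contradiction.\<close>
  have dens: "form_density c u \<psi> x \<le> form_density (\<lambda>_. 1) v v x / 4 + \<mu> x * c x * (u x * \<psi> x)" for x
  proof -
    have "(\<Sum>y | (x, y) \<in> E. w x y * ((u y - u x) * (\<psi> y - \<psi> x))) \<le>
        (\<Sum>y | (x, y) \<in> E. w x y * ((v y - v x)\<^sup>2 / 4))"
      unfolding \<psi>_def using weight_pos
      by (intro sum_mono mult_left_mono truncation_edge_bound) (auto intro: less_imp_le)
    moreover have "0 \<le> \<mu> x * (v x * v x)" using measure_pos[of x] by simp
    moreover have "p / 2 + s \<le> (q / 2 + r) / 4 + s" if "p \<le> q / 4" "0 \<le> r" for p q r s :: real
      using that by simp
    ultimately show ?thesis
      unfolding form_density_def mult.assoc power2_eq_square times_divide_eq_right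
        sum_divide_distrib[symmetric] mult_1_left by blast
  qed
  have "u x * \<psi> x \<le> 0" for x by (auto simp: \<psi>_def max_def mult_le_0_iff)
  then have neg: "\<mu> x * c x * (u x * \<psi> x) \<le> 0" for x
    using measure_pos[of x] c[of x] by (simp add: mult_nonneg_nonpos)
  have "0 \<le> (\<Sum>x\<in>F. \<mu> x * schroedinger c u x * \<psi> x)"
    using measure_pos super by (intro sum_nonneg) (auto simp: \<psi>_def less_imp_le)
  also have "\<dots> = form c u \<psi>" using green_formula[OF F supp] by simp
  also have "\<dots> = sum (form_density c u \<psi>) F" by (rule form_eq_sum[OF F supp])
  also have "\<dots> \<le> (\<Sum>x\<in>F. form_density (\<lambda>_. 1) v v x / 4 + \<mu> x * c x * (u x * \<psi> x))"
    by (intro sum_mono dens)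
  also have "\<dots> = sum (form_density (\<lambda>_. 1) v v) F / 4 + (\<Sum>x\<in>F. \<mu> x * c x * (u x * \<psi> x))"
    by (simp add: sum.distrib sum_divide_distrib)
  \<comment> \<open>All terms are nonpositive, so discarding all but the one at \<open>a\<close> can
    only increase the sum.\<close>
  also have "(\<Sum>x\<in>F. \<mu> x * c x * (u x * \<psi> x)) \<le> (\<Sum>x\<in>{a}. \<mu> x * c x * (u x * \<psi> x))"
    using F neg sum_nonneg[of "F - {a}" "\<lambda>x. - (\<mu> x * c x * (u x * \<psi> x))"]
    by (subst sum.remove[of F a]) (auto simp: F_def sum_negf)
  finally have 1: "\<mu> a * c a * (m * \<psi> a) \<le> e / 4" using sum_le[OF F] by (simp add: m_def)
  have "\<mu> a * (v a)\<^sup>2 \<le> e"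
    using sum_le[of "{a}"] form_density_ge[where c = "\<lambda>_. 1" and u = v and x = a] by simp
  also have "e \<le> \<mu> a * (m / 2)\<^sup>2" by (simp add: e_def power_divide)
  finally have "\<bar>v a\<bar> \<le> m / 2" using measure_pos[of a] m abs_le_square_iff[of "v a" "m / 2"] by simp
  then have "m / 2 \<le> \<psi> a" by (simp add: \<psi>_def m_def)
  then have "\<mu> a * c a * (m * (m / 2)) \<le> \<mu> a * c a * (m * \<psi> a)"
    using m measure_pos[of a] c[of a] by (intro mult_left_mono) auto
  also note 1
  also have "e / 4 \<le> \<mu> a * c a * m\<^sup>2 / 4" by (simp add: e_def)
  finally show False using m measure_pos[of a] c[of a] by (simp add: power2_eq_square)
qed

text \<open>At a zero \<open>x\<close>, \<open>\<mu> x * schroedinger c u x\<close> is minus the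
  weighted sum of the neighbouring values. These are nonnegative and their sum is nonpositive, so
  every neighbour is again a zero, and connectedness carries this to \<open>b\<close>.\<close>

lemma strong_maximum_principle:
  assumes nonneg: "\<And>x. u x \<ge> 0" and super: "\<And>x. schroedinger c u x \<ge> 0" and zero: "u a = 0"
  shows "u b = 0"
  using connected[of a b]
proof (induction rule: rtrancl_induct)
  case (step x y)
  have "(\<Sum>y | (x, y) \<in> E. w x y * u y) \<le> 0"
    using mult_nonneg_nonneg[OF less_imp_le[OF measure_pos[of x]] super[of x]] step.IH
    by (simp add: schroedinger_eq)
  moreover have terms: "w x y * u y \<ge> 0" if "(x, y) \<in> E" for y
    using nonneg weight_pos that by (simp add: less_imp_le)
  ultimately have "(\<Sum>y | (x, y) \<in> E. w x y * u y) = 0" 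
    by (intro antisym sum_nonneg) auto
  then have "w x y * u y = 0" 
    using step.hyps(2) terms sum_nonneg_eq_0_iff[OF finite_nbrs[of x], of "\<lambda>y. w x y * u y"] by auto
  with weight_pos[OF step.hyps(2)] show ?case by simp
qed (rule zero)

section \<open>Norm comparison and the energy functional on \<open>Cc\<close>\<close>

lemma schroedinger_diff:
  "schroedinger c (\<lambda>x. u x - v x) x = schroedinger c u x - schroedinger c v x"
proof -
  have "\<mu> x * schroedinger c (\<lambda>x. u x - v x) x = \<mu> x * (schroedinger c u x - schroedinger c v x)"
    by (simp add: schroedinger_eq right_diff_distrib sum_subtractf)
  then show ?thesis using measure_pos[of x] by simp
qed

text \<open>In the constant, 1 serves the edge part and \<open>1 / a0\<close> the zeroth-order part.
  Convergence in the energy of the equation thus implies convergence in \<open>W12\<close>.\<close>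

lemma form_density_compare:
  assumes "a0 > 0" "\<And>x. c x \<ge> a0"
  shows "form_density (\<lambda>_. 1) u u x \<le> (1 + 1 / a0) * form_density c u u x"
proof -
  let ?S = "(\<Sum>y | (x, y) \<in> E. w x y * (u y - u x) * (u y - u x))"
  have "?S / 2 \<le> (1 + 1 / a0) * (?S / 2)"
    using edge_sum_nonneg[of x u] assms mult_right_mono[of 1 "1 + 1 / a0" "?S / 2"] by simp
  moreover have "1 \<le> c x / a0" "0 < c x" using assms(1) assms(2)[of x] by simp_all
  then have "1 \<le> (1 + 1 / a0) * c x" by (simp add: distrib_right)
  then have "1 * (\<mu> x * (u x * u x)) \<le> (1 + 1 / a0) * c x * (\<mu> x * (u x * u x))"
    using measure_pos[of x] by (intro mult_right_mono) auto
  ultimately show ?thesis unfolding form_density_def distrib_left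
    by (intro add_mono) (auto simp: mult_ac)
qed

lemma form_add_scale:
  assumes "\<phi> \<in> Cc" "\<psi> \<in> Cc"
  shows "form c (\<lambda>x. \<phi> x + t * \<psi> x) (\<lambda>x. \<phi> x + t * \<psi> x) =
    form c \<phi> \<phi> + 2 * t * form c \<phi> \<psi> + t\<^sup>2 * form c \<psi> \<psi>"
  unfolding form_def form_density_add_scale
  by (simp add: infsum_add infsum_cmult_right' summable_on_add summable_on_cmult_right
      form_density_summable assms)

definition pairing :: "('a \<Rightarrow> real) \<Rightarrow> ('a \<Rightarrow> real) \<Rightarrow> real" where
  "pairing f \<phi> = (\<Sum>\<^sub>\<infinity>x. \<mu> x * f x * \<phi> x)"

lemma pairing_summable: "\<phi> \<in> Cc \<Longrightarrow> (\<lambda>x. \<mu> x * f x * \<phi> x) summable_on UNIV"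
  by (rule summable_on_finite_support[of "{x. \<phi> x \<noteq> 0}"]) (auto simp: Cc_def)

lemma pairing_add_scale:
  assumes "\<phi> \<in> Cc" "\<psi> \<in> Cc"
  shows "pairing f (\<lambda>x. \<phi> x + t * \<psi> x) = pairing f \<phi> + t * pairing f \<psi>"
proof -
  have "pairing f (\<lambda>x. \<phi> x + t * \<psi> x) = (\<Sum>\<^sub>\<infinity>x. \<mu> x * f x * \<phi> x + t * (\<mu> x * f x * \<psi> x))"
    unfolding pairing_def by (simp add: algebra_simps)
  then show ?thesis unfolding pairing_def
    by (simp add: infsum_add infsum_cmult_right' summable_on_cmult_right pairing_summable assms)
qed

definition energy :: "('a \<Rightarrow> real) \<Rightarrow> ('a \<Rightarrow> real) \<Rightarrow> ('a \<Rightarrow> real) \<Rightarrow> real" where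
  "energy c f \<phi> = form c \<phi> \<phi> / 2 - pairing f \<phi>"

text \<open>The coefficient of \<open>t\<close> is the weak form of the equation tested with
  \<open>\<psi>\<close>.\<close>

lemma energy_add_scale:
  assumes "\<phi> \<in> Cc" "\<psi> \<in> Cc"
  shows "energy c f (\<lambda>x. \<phi> x + t * \<psi> x) =
    energy c f \<phi> + t * (form c \<phi> \<psi> - pairing f \<psi>) + t\<^sup>2 * (form c \<psi> \<psi> / 2)"
  unfolding energy_def form_add_scale[OF assms] pairing_add_scale[OF assms]
  by (simp add: field_simps)

text \<open>Quantitative convexity: the expansions along the segment at \<open>t = 1\<close> and
  \<open>t = 1 / 2\<close> are combined so that the linear coefficient cancels, which leaves 1/4 -
  1/8 = 1/8 of the form.\<close>

lemma energy_midpoint: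
  assumes "\<phi> \<in> Cc" "\<psi> \<in> Cc"
  shows "energy c f (\<lambda>x. \<phi> x + 1 / 2 * (\<psi> x - \<phi> x)) =
    (energy c f \<phi> + energy c f \<psi>) / 2 - form c (\<lambda>x. \<psi> x - \<phi> x) (\<lambda>x. \<psi> x - \<phi> x) / 8"
  using energy_add_scale[OF assms(1) Cc_diff[OF assms(2,1)], of c f 1]
    energy_add_scale[OF assms(1) Cc_diff[OF assms(2,1)], of c f "1 / 2"]
  by (simp add: power2_eq_square field_simps)

lemma form_delta: "form c u (\<lambda>x. of_bool (x = a)) = \<mu> a * schroedinger c u a"
proof -
  let ?F = "closed_nbhd {a}"
  have "a \<in> ?F" "finite ?F" using finite_closed_nbhd by (auto simp: closed_nbhd_def)
  then have "form c u (\<lambda>x. of_bool (x = a)) =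
      (\<Sum>x\<in>?F. \<mu> x * schroedinger c u x * of_bool (x = a))"
    by (intro green_formula) auto
  also have "\<dots> = (\<Sum>x\<in>{a}. \<mu> x * schroedinger c u x * of_bool (x = a))"
    using \<open>a \<in> ?F\<close> \<open>finite ?F\<close> by (intro sum.mono_neutral_right) auto
  finally show ?thesis by simp
qed

lemma pairing_delta: "pairing f (\<lambda>x. of_bool (x = a)) = \<mu> a * f a"
  unfolding pairing_def by (subst infsum_eq_sum_support[of "{a}"]) auto

lemma schroedinger_tendsto:
  assumes "\<And>x. (\<lambda>n. \<phi> n x) \<longlonglongrightarrow> u x"
  shows "(\<lambda>n. schroedinger c (\<phi> n) x) \<longlonglongrightarrow> schroedinger c u x"
  unfolding schroedinger_def laplacian_def by (intro tendsto_intros assms)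

text \<open>Lower semicontinuity in the manner of Fatou: the density is a finite sum at each vertex,
  so finite partial sums pass to the limit. The bounds \<open>r n\<close> may vary, as the Cauchy
  estimate keeps a vanishing term in the running index.\<close>

lemma form_le_of_pointwise_limit:
  assumes lim: "\<And>x. (\<lambda>n. \<phi> n x) \<longlonglongrightarrow> u x" and c: "\<And>x. c x \<ge> 0"
    and \<phi>: "\<And>n. \<phi> n \<in> Cc" and le: "\<And>n. form c (\<phi> n) (\<phi> n) \<le> r n" and r: "r \<longlonglongrightarrow> b"
  shows "form_density c u u summable_on UNIV" "form c u u \<le> b"
proof -
  have sum_le: "sum (form_density c u u) A \<le> b" if "finite A" for A
  proof (rule LIMSEQ_le)
    show "(\<lambda>n. sum (form_density c (\<phi> n) (\<phi> n)) A) \<longlonglongrightarrow> sum (form_density c u u) A"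
      unfolding form_density_def by (intro tendsto_intros lim) simp
    have "sum (form_density c (\<phi> n) (\<phi> n)) A \<le> form c (\<phi> n) (\<phi> n)" for n
      unfolding form_def using \<phi> c that
      by (intro finite_sum_le_infsum form_density_summable form_density_nonneg) auto
    then show "\<exists>N. \<forall>n\<ge>N. sum (form_density c (\<phi> n) (\<phi> n)) A \<le> r n"
      using le order_trans by blast
  qed (rule r)
  show summable: "form_density c u u summable_on UNIV"
    by (rule nonneg_bdd_above_summable_on)
      (auto intro!: form_density_nonneg c bdd_aboveI2 sum_le)
  show "form c u u \<le> b" unfolding form_def
    by (rule infsum_le_finite_sums[OF summable sum_le])
qed

section \<open>Existence by minimisation\<close>

lemma solution_exists:
  assumes a0: "a0 > 0" and c_ge: "\<And>x. c x \<ge> a0"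
    and bdd: "\<And>\<phi>. \<phi> \<in> Cc \<Longrightarrow> energy c f \<phi> \<ge> B"
  shows "\<exists>u. is_solution E w \<mu> c f u"
proof -
  have c_nonneg: "c x \<ge> 0" for x using a0 c_ge[of x] by simp
  define I where "I = Inf (energy c f ` Cc)"
  have bdd_below: "bdd_below (energy c f ` Cc)" using bdd by (intro bdd_belowI2)
  have I_le: "I \<le> energy c f \<phi>" if "\<phi> \<in> Cc" for \<phi>
    unfolding I_def using bdd_below that by (intro cInf_lower) auto
  have "\<exists>\<phi>\<in>Cc. energy c f \<phi> < I + 1 / Suc n" for n
    using cInf_lessD[of "energy c f ` Cc" "I + 1 / Suc n"] Cc_zero by (auto simp: I_def)
  then obtain \<phi> where \<phi>: "\<And>n. \<phi> n \<in> Cc" and near: "\<And>n. energy c f (\<phi> n) < I + 1 / Suc n"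
    by metis
  \<comment> \<open>The midpoint of two almost minimisers has energy at least \<open>I\<close>, so
    the gap \<open>form / 8\<close> in \<open>energy_midpoint\<close> is at most the mean of
    \<open>1 / Suc n\<close> and \<open>1 / Suc m\<close>.\<close>
  have cauchy: "form c (\<lambda>x. \<phi> m x - \<phi> n x) (\<lambda>x. \<phi> m x - \<phi> n x) \<le> 4 / Suc n + 4 / Suc m" for m n
  proof -
    have "(\<lambda>x. \<phi> n x + 1 / 2 * (\<phi> m x - \<phi> n x)) \<in> Cc" by (intro Cc_add Cc_scale Cc_diff \<phi>)
    from I_le[OF this] show ?thesis
      using near[of n] near[of m] unfolding energy_midpoint[OF \<phi> \<phi>] by argo
  qed
  have "convergent (\<lambda>n. \<phi> n x)" for x
  proof -
    have "Cauchy (\<lambda>n. \<phi> n x)"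
    proof (rule CauchyI)
      fix e :: real assume e: "e > 0"
      have pos: "\<mu> x * a0 * e\<^sup>2 > 0" using e a0 measure_pos[of x] by simp
      \<comment> \<open>The Cauchy bound has two terms, each at most \<open>4 / Suc N\<close>; hence
        the divisor 8.\<close>
      then obtain N where N: "1 / Suc N < \<mu> x * a0 * e\<^sup>2 / 8"
        using nat_approx_posE[of "\<mu> x * a0 * e\<^sup>2 / 8"] by auto
      have "norm (\<phi> m x - \<phi> n x) < e" if "m \<ge> N" "n \<ge> N" for m n
      proof -
        let ?d = "\<lambda>x. \<phi> m x - \<phi> n x"
        have "\<mu> x * a0 * (?d x)\<^sup>2 \<le> \<mu> x * c x * (?d x)\<^sup>2"
          using measure_pos[of x] c_ge[of x] by (intro mult_right_mono mult_left_mono) auto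
        also have "\<dots> \<le> form_density c ?d ?d x" by (rule form_density_ge)
        also have "\<dots> = sum (form_density c ?d ?d) {x}" by simp
        also have "\<dots> \<le> form c ?d ?d" unfolding form_def
          by (intro finite_sum_le_infsum form_density_summable form_density_nonneg Cc_diff \<phi> c_nonneg)
            auto
        also have "\<dots> \<le> 4 / Suc n + 4 / Suc m" by (rule cauchy)
        also have "\<dots> \<le> 4 / Suc N + 4 / Suc N"
          using that by (intro add_mono divide_left_mono) auto
        also have "\<dots> < \<mu> x * a0 * e\<^sup>2" using N by simp
        finally have "(?d x)\<^sup>2 < e\<^sup>2" using a0 measure_pos[of x] by simp
        then show ?thesis using e abs_le_square_iff[of e "?d x"] by simp
      qed
      then show "\<exists>M. \<forall>m\<ge>M. \<forall>n\<ge>M. norm (\<phi> m x - \<phi> n x) < e" by blast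
    qed
    then show ?thesis by (rule Cauchy_convergent)
  qed
  then obtain u where u: "\<And>x. (\<lambda>n. \<phi> n x) \<longlonglongrightarrow> u x"
    unfolding convergent_def by metis

  have "(\<lambda>m. 4 / Suc n + 4 / Suc m) \<longlonglongrightarrow> 4 / Suc n + 0" for n
    by (intro tendsto_intros LIMSEQ_Suc[OF lim_const_over_n])
  then have r: "(\<lambda>m. 4 / Suc n + 4 / Suc m) \<longlonglongrightarrow> 4 / Suc n" for n by simp
  have lim: "(\<lambda>m. \<phi> m x - \<phi> n x) \<longlonglongrightarrow> u x - \<phi> n x" for n x by (intro tendsto_intros u)
  \<comment> \<open>Fixing \<open>n\<close> and letting \<open>m\<close> tend to infinity in the
    Cauchy estimate: \<open>u - \<phi> n\<close> has finite form, at most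
    \<open>4 / Suc n\<close>.\<close>
  note limit = form_le_of_pointwise_limit[OF lim c_nonneg Cc_diff[OF \<phi> \<phi>] cauchy r]

  have u_summable: "form_density c u u summable_on UNIV"
  proof (rule summable_on_nonneg_comparison)
    let ?d = "\<lambda>x. u x - \<phi> 0 x"
    show "(\<lambda>x. 2 * form_density c ?d ?d x + 2 * form_density c (\<phi> 0) (\<phi> 0) x) summable_on UNIV"
      by (intro summable_on_add summable_on_cmult_right limit form_density_summable \<phi>)
    show "form_density c u u x \<le> 2 * form_density c ?d ?d x + 2 * form_density c (\<phi> 0) (\<phi> 0) x" for x
      using form_density_add_le[where c = c and u = ?d and v = "\<phi> 0" and x = x] c_nonneg by simp
  qed (simp add: form_density_nonneg c_nonneg)
  define K where "K = 1 + 1 / a0"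
  have K: "K > 0" using a0 by (simp add: K_def add_pos_pos)
  have W12: "form_density (\<lambda>_. 1) v v summable_on UNIV" "form (\<lambda>_. 1) v v \<le> K * form c v v"
    if "form_density c v v summable_on UNIV" for v
  proof -
    have g: "(\<lambda>x. K * form_density c v v x) summable_on UNIV"
      using that by (rule summable_on_cmult_right)
    have le: "form_density (\<lambda>_. 1) v v x \<le> K * form_density c v v x" for x
      unfolding K_def by (rule form_density_compare[OF a0 c_ge])
    show s: "form_density (\<lambda>_. 1) v v summable_on UNIV"
      using g by (rule summable_on_nonneg_comparison) (auto simp: form_density_nonneg le)
    show "form (\<lambda>_. 1) v v \<le> K * form c v v"
      unfolding form_def using infsum_mono[OF s g le] by (simp add: infsum_cmult_right')
  qed
  have "\<exists>\<psi>\<in>Cc. W12_norm E w \<mu> (\<lambda>x. u x - \<psi> x) < \<epsilon>" if "\<epsilon> > 0" for \<epsilon>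
  proof -
    have "\<epsilon>\<^sup>2 / (4 * K) > 0" using that K by simp
    then obtain n where n: "1 / Suc n < \<epsilon>\<^sup>2 / (4 * K)"
      using nat_approx_posE by blast
    let ?d = "\<lambda>x. u x - \<phi> n x"
    have "form (\<lambda>_. 1) ?d ?d \<le> K * form c ?d ?d" by (rule W12) (rule limit)
    also have "\<dots> \<le> K * (4 / Suc n)" using K by (intro mult_left_mono limit) simp
    also have "\<dots> < \<epsilon>\<^sup>2" using n K by (simp add: field_simps)
    finally have "W12_norm E w \<mu> ?d < \<epsilon>" using that by (simp add: W12_norm_eq real_less_lsqrt)
    with \<phi> show ?thesis by blast
  qed
  then have "u \<in> W12_0 E w \<mu>" using W12[OF u_summable] by (simp add: W12_0_def W12_iff)

  moreover have "schroedinger c u a = f a" for a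
  proof -
    let ?\<delta> = "\<lambda>x. of_bool (x = a)"
    \<comment> \<open>Moving the almost minimiser \<open>\<phi> n\<close> by \<open>t\<close> times
      a point mass lowers the energy by less than \<open>1 / Suc n\<close>. Only values at
      \<open>a\<close> and its neighbours enter, so pointwise convergence suffices for the limit,
      and the linear coefficient must vanish.\<close>
    have "t * (\<mu> a * schroedinger c u a - \<mu> a * f a) + t\<^sup>2 * (form c ?\<delta> ?\<delta> / 2) \<ge> 0" for t
    proof (rule LIMSEQ_le)
      let ?g = "\<lambda>n. t * (\<mu> a * schroedinger c (\<phi> n) a - \<mu> a * f a) + t\<^sup>2 * (form c ?\<delta> ?\<delta> / 2)"
      show "?g \<longlonglongrightarrow> t * (\<mu> a * schroedinger c u a - \<mu> a * f a) + t\<^sup>2 * (form c ?\<delta> ?\<delta> / 2)"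
        by (intro tendsto_intros schroedinger_tendsto u)
      show "(\<lambda>n. - (1 / Suc n)) \<longlonglongrightarrow> 0"
        using tendsto_minus[OF LIMSEQ_Suc[OF lim_const_over_n[of 1]]] by simp
      have "- (1 / Suc n) \<le> ?g n" for n
        using I_le[OF Cc_add[OF \<phi>[of n] Cc_scale[OF Cc_delta[of a], of t]]] near[of n]
        unfolding energy_add_scale[OF \<phi> Cc_delta] form_delta[of c "\<phi> n"] pairing_delta by linarith
      then show "\<exists>N. \<forall>n\<ge>N. - (1 / Suc n) \<le> ?g n" by blast
    qed
    then have "\<mu> a * schroedinger c u a - \<mu> a * f a = 0"
      by (rule nonneg_quadratic_imp_linear_coeff_zero)
    then show ?thesis using measure_pos[of a] by simp
  qed
  ultimately have "is_solution E w \<mu> c f u"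
    using u_summable by (simp add: is_solution_def H_space_iff schroedinger_def)
  then show ?thesis by blast
qed

section \<open>Lower bounds for the energy under the three hypotheses\<close>

text \<open>At each vertex the square of \<open>a0 * \<phi> x - f x\<close> bounds
  \<open>f x * \<phi> x\<close> by a multiple of \<open>(f x)\<^sup>2\<close> plus a term that half
  the form absorbs, so the bound is independent of \<open>\<phi>\<close>.\<close>

lemma energy_bounded_below_square_integrable:
  assumes a0: "a0 > 0" and c_ge: "\<And>x. c x \<ge> a0"
    and f: "f \<in> Lq_space \<mu> 2" and \<phi>: "\<phi> \<in> Cc"
  shows "energy c f \<phi> \<ge> - (\<Sum>\<^sub>\<infinity>x. 1 / (2 * a0) * (\<mu> x * (f x)\<^sup>2))"
proof -
  have f2: "(\<lambda>x. 1 / (2 * a0) * (\<mu> x * (f x)\<^sup>2)) summable_on UNIV"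
    using f by (intro summable_on_cmult_right) (simp add: Lq_space_def vintegrable_def)
  have le: "\<mu> x * f x * \<phi> x \<le>
      1 / 2 * form_density c \<phi> \<phi> x + 1 / (2 * a0) * (\<mu> x * (f x)\<^sup>2)" for x
  proof -
    have "0 \<le> \<mu> x * ((a0 * \<phi> x - f x)\<^sup>2 / (2 * a0))" using a0 measure_pos[of x] by simp
    also have "\<dots> = 1 / 2 * (\<mu> x * a0 * (\<phi> x)\<^sup>2) + 1 / (2 * a0) * (\<mu> x * (f x)\<^sup>2) - \<mu> x * f x * \<phi> x"
      using a0 by (simp add: power2_eq_square field_simps)
    also have "\<mu> x * a0 * (\<phi> x)\<^sup>2 \<le> \<mu> x * c x * (\<phi> x)\<^sup>2"
      using measure_pos[of x] c_ge[of x] by (intro mult_right_mono mult_left_mono) auto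
    also have "\<dots> \<le> form_density c \<phi> \<phi> x" by (rule form_density_ge)
    finally show ?thesis by simp
  qed
  have half: "(\<lambda>x. 1 / 2 * form_density c \<phi> \<phi> x) summable_on UNIV"
    by (intro summable_on_cmult_right form_density_summable \<phi>)
  have "pairing f \<phi> \<le> (\<Sum>\<^sub>\<infinity>x. 1 / 2 * form_density c \<phi> \<phi> x + 1 / (2 * a0) * (\<mu> x * (f x)\<^sup>2))"
    unfolding pairing_def by (intro infsum_mono pairing_summable \<phi> summable_on_add half f2 le)
  also have "\<dots> = form c \<phi> \<phi> / 2 + (\<Sum>\<^sub>\<infinity>x. 1 / (2 * a0) * (\<mu> x * (f x)\<^sup>2))"
    unfolding infsum_add[OF half f2] form_def infsum_cmult_right' by simp
  finally show ?thesis by (simp add: energy_def)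
qed

lemma form_nonneg: "(\<And>x. c x \<ge> 0) \<Longrightarrow> form c u u \<ge> 0"
  unfolding form_def by (intro infsum_nonneg form_density_nonneg)

text \<open>With \<open>s\<close> the energy norm of \<open>\<phi>\<close>, the pairing is at most
  \<open>s * C\<close>, and \<open>s\<^sup>2 / 2 - s * C\<close> is minimal at
  \<open>s = C\<close>.\<close>

lemma energy_bounded_below_pointwise:
  assumes c: "\<And>x. c x \<ge> 0"
    and g: "(\<lambda>x. \<mu> x * \<bar>f x\<bar> * g x) summable_on UNIV"
    and \<phi>: "\<phi> \<in> Cc" and le: "\<And>x. \<bar>\<phi> x\<bar> \<le> g x * sqrt (form c \<phi> \<phi>)"
  shows "energy c f \<phi> \<ge> - (\<Sum>\<^sub>\<infinity>x. \<mu> x * \<bar>f x\<bar> * g x)\<^sup>2 / 2"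
proof -
  define C where "C = (\<Sum>\<^sub>\<infinity>x. \<mu> x * \<bar>f x\<bar> * g x)"
  define s where "s = sqrt (form c \<phi> \<phi>)"
  have s2: "s\<^sup>2 = form c \<phi> \<phi>" using form_nonneg[where c = c, OF c] by (simp add: s_def)
  have "\<mu> x * f x * \<phi> x \<le> s * (\<mu> x * \<bar>f x\<bar> * g x)" for x
  proof -
    have "\<mu> x * f x * \<phi> x \<le> \<mu> x * (\<bar>f x\<bar> * \<bar>\<phi> x\<bar>)"
      using measure_pos[of x] abs_ge_self[of "f x * \<phi> x"] by (simp add: mult.assoc abs_mult)
    also have "\<dots> \<le> \<mu> x * (\<bar>f x\<bar> * (g x * s))"
      using measure_pos[of x] le[of x] by (intro mult_left_mono) (auto simp: s_def)
    finally show ?thesis by (simp add: mult_ac)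
  qed
  then have "pairing f \<phi> \<le> (\<Sum>\<^sub>\<infinity>x. s * (\<mu> x * \<bar>f x\<bar> * g x))"
    unfolding pairing_def by (intro infsum_mono pairing_summable \<phi> summable_on_cmult_right g)
  also have "\<dots> = s * C" by (simp add: C_def infsum_cmult_right')
  finally have "energy c f \<phi> \<ge> s\<^sup>2 / 2 - s * C" by (simp add: energy_def s2)
  moreover have "0 \<le> (s - C)\<^sup>2" by simp
  then have "s\<^sup>2 / 2 - s * C \<ge> - C\<^sup>2 / 2" by (simp add: power2_eq_square algebra_simps)
  ultimately show ?thesis by (simp add: C_def)
qed

lemma form_density_le_form:
  assumes "\<phi> \<in> Cc" "\<And>x. c x \<ge> 0"
  shows "form_density c \<phi> \<phi> x \<le> form c \<phi> \<phi>"
  using finite_sum_le_infsum[OF form_density_summable[OF assms(1), of c \<phi>], of "{x}"]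
    form_density_nonneg assms(2) by (simp add: form_def)

text \<open>The zeroth-order density at a single vertex is already bounded by the form. A lower
  bound on \<open>\<mu>\<close> makes the estimate uniform; otherwise it anchors the path estimate
  at its end point.\<close>

lemma abs_le_form:
  assumes a0: "a0 > 0" and c_ge: "\<And>x. c x \<ge> a0" and \<phi>: "\<phi> \<in> Cc"
  shows "\<bar>\<phi> x\<bar> \<le> 1 / sqrt (a0 * \<mu> x) * sqrt (form c \<phi> \<phi>)"
proof -
  have "a0 * \<mu> x * (\<phi> x)\<^sup>2 \<le> \<mu> x * c x * (\<phi> x)\<^sup>2"
    using measure_pos[of x] c_ge[of x] by (intro mult_right_mono) (auto simp: mult.commute)
  also have "\<dots> \<le> form_density c \<phi> \<phi> x" by (rule form_density_ge)
  also have "\<dots> \<le> form c \<phi> \<phi>"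
    using a0 c_ge by (intro form_density_le_form \<phi>) (meson less_imp_le order_trans)
  finally have "sqrt (a0 * \<mu> x * (\<phi> x)\<^sup>2) \<le> sqrt (form c \<phi> \<phi>)" by simp
  then show ?thesis using a0 measure_pos[of x] by (simp add: real_sqrt_mult field_simps)
qed

text \<open>The density at \<open>x\<close> contains this edge with the factor 1/2, whence the 2
  under the root.\<close>

lemma edge_diff_le_form:
  assumes w0: "w0 > 0" and "w x y \<ge> w0" and c: "\<And>x. c x \<ge> 0" and \<phi>: "\<phi> \<in> Cc"
    and edge: "(x, y) \<in> E"
  shows "\<bar>\<phi> y - \<phi> x\<bar> \<le> sqrt (2 / w0) * sqrt (form c \<phi> \<phi>)"
proof -
  have "w0 * (\<phi> y - \<phi> x)\<^sup>2 \<le> w x y * (\<phi> y - \<phi> x)\<^sup>2" using assms(2) by (intro mult_right_mono) auto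
  also have "\<dots> = (\<Sum>y\<in>{y}. w x y * (\<phi> y - \<phi> x) * (\<phi> y - \<phi> x))" by (simp add: power2_eq_square)
  also have "\<dots> \<le> (\<Sum>y | (x, y) \<in> E. w x y * (\<phi> y - \<phi> x) * (\<phi> y - \<phi> x))"
    unfolding mult.assoc using edge weight_pos finite_nbrs
    by (intro sum_mono2 mult_nonneg_nonneg[OF _ zero_le_square]) (auto intro: less_imp_le)
  also have "\<dots> \<le> 2 * form_density c \<phi> \<phi> x"
    using c[of x] measure_pos[of x] by (simp add: form_density_def mult.assoc)
  also have "\<dots> \<le> 2 * form c \<phi> \<phi>" using form_density_le_form[where c = c, OF \<phi> c] by simp
  finally have "(\<phi> y - \<phi> x)\<^sup>2 \<le> 2 / w0 * form c \<phi> \<phi>" using w0 by (simp add: field_simps)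
  then have "sqrt ((\<phi> y - \<phi> x)\<^sup>2) \<le> sqrt (2 / w0 * form c \<phi> \<phi>)" by (rule real_sqrt_le_mono)
  then show ?thesis by (simp only: real_sqrt_mult real_sqrt_abs)
qed

lemma graph_dist_path: "(x, y) \<in> E ^^ graph_dist E x y"
proof -
  obtain n where "(x, y) \<in> E ^^ n" using connected[of x y] rtrancl_imp_relpow by blast
  then show ?thesis unfolding graph_dist_def by (rule LeastI)
qed

lemma abs_le_dist_form:
  assumes w0: "w0 > 0" "\<And>x y. (x, y) \<in> E \<Longrightarrow> w x y \<ge> w0"
    and a0: "a0 > 0" and c_ge: "\<And>x. c x \<ge> a0" and \<phi>: "\<phi> \<in> Cc"
  shows "\<bar>\<phi> x\<bar> \<le> (1 / sqrt (a0 * \<mu> a) + sqrt (2 / w0) * real (graph_dist E x a)) * sqrt (form c \<phi> \<phi>)"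
proof -
  have c: "c x \<ge> 0" for x using a0 c_ge[of x] by simp
  \<comment> \<open>Stated for walks of any length, so that the induction need not know that the
    tail of a shortest path is shortest.\<close>
  have "\<bar>\<phi> x\<bar> \<le> (1 / sqrt (a0 * \<mu> a) + sqrt (2 / w0) * real n) * sqrt (form c \<phi> \<phi>)"
    if "(x, a) \<in> E ^^ n" for n
    using that
  proof (induction n arbitrary: x)
    case 0
    then show ?case using abs_le_form[where c = c, OF a0 c_ge \<phi>, of a] by simp
  next
    case (Suc n)
    obtain y where y: "(x, y) \<in> E" "(y, a) \<in> E ^^ n" using relpow_Suc_D2[OF Suc.prems] by blast
    have "\<bar>\<phi> x\<bar> \<le> \<bar>\<phi> y\<bar> + \<bar>\<phi> y - \<phi> x\<bar>" by simp
    with Suc.IH[OF y(2)] edge_diff_le_form[where c = c, OF w0(1) w0(2)[OF y(1)] c \<phi> y(1)]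
    show ?case by (simp add: algebra_simps)
  qed
  then show ?thesis using graph_dist_path by blast
qed

text \<open>Young's inequality with conjugate exponents handles \<open>\<bar>f\<bar>\<close> times
  the distance. The constant \<open>C\<close> cannot be treated by itself, as \<open>f\<close> need
  not be in \<open>L\<^sup>1\<close> a priori; but the distance is at least 1 off \<open>a\<close>,
  so \<open>C\<close> is absorbed there, and the vertex \<open>a\<close> adds a single term.\<close>

lemma product_with_dist_summable:
  assumes p: "p > 1" and dist: "(\<lambda>x. real (graph_dist E x a)) \<in> Lq_space \<mu> p"
    and f: "f \<in> Lq_space \<mu> (p / (p - 1))" and C: "C \<ge> 0" "D \<ge> 0"
  shows "(\<lambda>x. \<mu> x * \<bar>f x\<bar> * (C + D * real (graph_dist E x a))) summable_on UNIV"
proof -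
  define q where "q = p / (p - 1)"
  have q: "q > 1" "1 / p + 1 / q = 1" using p by (auto simp: q_def field_simps)
  let ?r = "\<lambda>x. real (graph_dist E x a)"
  let ?b = "\<lambda>x. (C + D) * (1 / p * (\<mu> x * \<bar>?r x\<bar> powr p) + 1 / q * (\<mu> x * \<bar>f x\<bar> powr q)) +
    of_bool (x = a) * (\<mu> x * \<bar>f x\<bar> * C)"
  have "?b summable_on UNIV"
    using dist f unfolding Lq_space_def vintegrable_def q_def[symmetric] mem_Collect_eq
    by (intro summable_on_add summable_on_cmult_right) (auto intro: summable_on_finite_support[of "{a}"])
  then show ?thesis
  proof (rule summable_on_nonneg_comparison)
    fix x
    show "0 \<le> \<mu> x * \<bar>f x\<bar> * (C + D * ?r x)"
      using measure_pos[of x] C by (intro mult_nonneg_nonneg add_nonneg_nonneg) auto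
    have "?r x * \<bar>f x\<bar> \<le> ?r x powr p / p + \<bar>f x\<bar> powr q / q"
      using p q by (intro Youngs_inequality) auto
    from mult_left_mono[OF this, of "\<mu> x"]
    have "\<mu> x * \<bar>f x\<bar> * ?r x \<le> 1 / p * (\<mu> x * \<bar>?r x\<bar> powr p) + 1 / q * (\<mu> x * \<bar>f x\<bar> powr q)"
      using measure_pos[of x] by (simp add: distrib_left mult_ac)
    then have young: "(C + D) * (\<mu> x * \<bar>f x\<bar> * ?r x) \<le>
        (C + D) * (1 / p * (\<mu> x * \<bar>?r x\<bar> powr p) + 1 / q * (\<mu> x * \<bar>f x\<bar> powr q))"
      using C by (intro mult_left_mono) auto
    have "(C + D * ?r x) \<le> (C + D) * ?r x + of_bool (x = a) * C"
    proof (cases "x = a")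
      case False
      have "graph_dist E x a \<noteq> 0" using graph_dist_path[of x a] False by (metis relpow_0_E)
      then have "?r x \<ge> 1" by simp
      then show ?thesis using False C mult_left_mono[of 1 "?r x" C] by (simp add: algebra_simps)
    qed (use C in \<open>simp add: algebra_simps\<close>)
    from mult_left_mono[OF this, of "\<mu> x * \<bar>f x\<bar>"]
    have "\<mu> x * \<bar>f x\<bar> * (C + D * ?r x) \<le>
        (C + D) * (\<mu> x * \<bar>f x\<bar> * ?r x) + of_bool (x = a) * (\<mu> x * \<bar>f x\<bar> * C)"
      using measure_pos[of x] by (simp add: algebra_simps)
    with young show "\<mu> x * \<bar>f x\<bar> * (C + D * ?r x) \<le> ?b x" by linarith
  qed
qed

section \<open>Comparison, uniqueness and positivity\<close>

text \<open>The difference \<open>v - u\<close> lies in \<open>W12_0\<close> and solves the equation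
  with right-hand side \<open>g - f \<ge> 0\<close>, so the weak maximum principle applies.\<close>

lemma solution_le:
  assumes c: "\<And>x. c x > 0" and u: "is_solution E w \<mu> c f u" and v: "is_solution E w \<mu> c g v"
    and le: "\<And>x. f x \<le> g x"
  shows "u x \<le> v x"
proof -
  have "(\<lambda>x. v x - u x) \<in> W12_0 E w \<mu>"
    using u v by (intro W12_0_diff) (auto simp: is_solution_def H_space_iff)
  moreover have "schroedinger c (\<lambda>x. v x - u x) x \<ge> 0" for x
    using u v le[of x] by (simp add: schroedinger_diff) (simp add: is_solution_def schroedinger_def)
  ultimately show ?thesis using weak_maximum_principle[of "\<lambda>x. v x - u x" c x] c by simp
qed

lemma solution_unique:
  assumes "\<And>x. c x > 0" "is_solution E w \<mu> c f u" "is_solution E w \<mu> c f v"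
  shows "u = v"
  using solution_le[where c = c, OF assms(1,2,3)] solution_le[where c = c, OF assms(1,3,2)]
  by (intro ext antisym) auto

lemma solution_positive:
  assumes c: "\<And>x. c x > 0" and u: "is_solution E w \<mu> c f u"
    and f: "\<And>x. f x \<ge> 0" "f b \<noteq> 0"
  shows "u a > 0"
proof (rule ccontr)
  have eq: "schroedinger c u x = f x" for x using u by (simp add: is_solution_def schroedinger_def)
  have mem: "u \<in> W12_0 E w \<mu>" using u by (simp add: is_solution_def H_space_iff)
  have nonneg: "u x \<ge> 0" for x
    by (rule weak_maximum_principle[OF mem, of c]) (simp_all add: eq f c)
  assume "\<not> u a > 0"
  with nonneg have "u a = 0" by (simp add: antisym not_less)
  \<comment> \<open>A single zero would spread to all vertices and force
    \<open>f b = 0\<close>.\<close>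
  have "u x = 0" for x
    by (rule strong_maximum_principle[of u c a]) (simp_all add: nonneg eq f \<open>u a = 0\<close>)
  then have "schroedinger c u b = 0" by (simp add: schroedinger_def laplacian_def)
  with f eq show False by simp
qed

end

theorem theorem3:
  fixes E :: "('a \<times> 'a) set"
    and w :: "'a \<Rightarrow> 'a \<Rightarrow> real"
    and \<mu> h f :: "'a \<Rightarrow> real"
  assumes graph: "connected_weighted_graph E w \<mu>"
    and loc_fin: "locally_finite_graph E"
    and h_lower: "\<exists>a0>0. \<forall>x. h x \<ge> a0"
    and hyp:
      "f \<in> Lq_space \<mu> 2
       \<or> ((\<exists>\<mu>0>0. \<forall>x. \<mu> x \<ge> \<mu>0) \<and> f \<in> Lq_space \<mu> 1)
       \<or> ((\<exists>w0>0. \<forall>x y. (x, y) \<in> E \<longrightarrow> w x y \<ge> w0) \<and>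
          (\<exists>p>1. (\<exists>x0. (\<lambda>x. real (graph_dist E x x0)) \<in> Lq_space \<mu> p) \<and>
                 f \<in> Lq_space \<mu> (p / (p - 1))))"
  shows "(\<exists>!u. is_solution E w \<mu> h f u) \<and>
         ((\<forall>x. f x \<ge> 0) \<and> (\<exists>x. f x \<noteq> 0) \<longrightarrow>
            (\<forall>u. is_solution E w \<mu> h f u \<longrightarrow> (\<forall>x. u x > 0)))"
proof -
  interpret locally_finite_weighted_graph E w \<mu>
    using graph loc_fin
    by (simp add: locally_finite_weighted_graph_def locally_finite_weighted_graph_axioms_def)
  obtain a0 where a0: "a0 > 0" and h_ge: "\<And>x. h x \<ge> a0" using h_lower by blast
  have h_pos: "h x > 0" for x using a0 h_ge[of x] by simp
  \<comment> \<open>The three alternatives enter only here, through a lower bound of the energy on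
    \<open>Cc\<close>.\<close>
  have "\<exists>B. \<forall>\<phi>\<in>Cc. energy h f \<phi> \<ge> B"
    using hyp
  proof (elim disjE conjE exE)
    assume "f \<in> Lq_space \<mu> 2"
    then show ?thesis using energy_bounded_below_square_integrable[where c = h, OF a0 h_ge] by blast
  next
    fix \<mu>0 assume \<mu>0: "\<mu>0 > 0" "\<forall>x. \<mu> x \<ge> \<mu>0" and f: "f \<in> Lq_space \<mu> 1"
    let ?g = "\<lambda>x. 1 / sqrt (a0 * \<mu>0)"
    have "(\<lambda>x. \<mu> x * \<bar>f x\<bar> * ?g x) summable_on UNIV"
      using f by (intro summable_on_cmult_left) (simp add: Lq_space_def vintegrable_def)
    moreover have "\<bar>\<phi> x\<bar> \<le> ?g x * sqrt (form h \<phi> \<phi>)" if "\<phi> \<in> Cc" for \<phi> x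
    proof -
      have "\<bar>\<phi> x\<bar> \<le> 1 / sqrt (a0 * \<mu> x) * sqrt (form h \<phi> \<phi>)" 
        by (intro abs_le_form a0 h_ge that)
      also have "\<dots> \<le> ?g x * sqrt (form h \<phi> \<phi>)"
        using \<mu>0 a0 measure_pos[of x] form_nonneg[of h \<phi>, OF less_imp_le[OF h_pos]]
        by (intro mult_right_mono divide_left_mono) auto
      finally show ?thesis .
    qed
    ultimately show ?thesis
      using energy_bounded_below_pointwise[where c = h and g = ?g, OF less_imp_le[OF h_pos]] by blast
  next
    fix w0 p x0
    assume w0: "w0 > 0" "\<forall>x y. (x, y) \<in> E \<longrightarrow> w x y \<ge> w0" and p: "p > 1"
      and dist: "(\<lambda>x. real (graph_dist E x x0)) \<in> Lq_space \<mu> p"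
      and f: "f \<in> Lq_space \<mu> (p / (p - 1))"
    let ?g = "\<lambda>x. 1 / sqrt (a0 * \<mu> x0) + sqrt (2 / w0) * real (graph_dist E x x0)"
    have "(\<lambda>x. \<mu> x * \<bar>f x\<bar> * ?g x) summable_on UNIV"
      using a0 w0 measure_pos[of x0] by (intro product_with_dist_summable[OF p dist f]) auto
    moreover have "\<bar>\<phi> x\<bar> \<le> ?g x * sqrt (form h \<phi> \<phi>)" if "\<phi> \<in> Cc" for \<phi> x
      using w0 by (intro abs_le_dist_form a0 h_ge that) auto
    ultimately show ?thesis
      using energy_bounded_below_pointwise[where c = h and g = ?g, OF less_imp_le[OF h_pos]] by blast
  qed
  then obtain u where "is_solution E w \<mu> h f u" using solution_exists[where c = h, OF a0 h_ge] by blast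
  then show ?thesis using solution_unique[where c = h, OF h_pos] solution_positive[where c = h, OF h_pos]
    by blast
qed

end
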